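(* Consider $n>d+1$ agents in $\mathbb{R}^d$ with dynamics $\dot p_i=u_i$, $i\in\mathcal{V}=\{1,\dots,n\}$, under the gradient control law $u_i=-\nabla_{p_i}V(p)$, where $$V(p)=\frac12\sum_{(i,j,k)\in\mathcal{T}_{\mathcal{G}_f}^*}\left(e_{ij}^Te_{ik}-e_{ij}^{*T}e_{ik}^*\right)^2 .$$ If the target framework $(\mathcal{G}_f,p^* )$ with $\mathcal{T}_{\mathcal{G}_f}^*$ is infinitesimally weakly rigid, then the set $$\mathscr{E}=\{p\in\mathbb{R}^{nd}:(p_i-p_j)^T(p_i-p_k)=(p_i^*-p_j^* )^T(p_i^*-p_k^* )\ \text{for all } i,j,k\in\mathcal{V}\}$$ is locally exponentially stable.
   Context: $\mathcal{G}_f=(\mathcal{V},\mathcal{E}_f)$ (formation graph) and $\mathcal{G}_s=(\mathcal{V},\mathcal{E}_s)$ (sensing graph) are finite simple undirected graphs with $\mathcal{E}_f\subseteq\mathcal{E}_s$; $(i,j)$ and $(j,i)$ denote the same edge. $p=(p_1^T,\dots,p_n^T)^T\in\mathbb{R}^{nd}$ is the stacked state, $p^*=(p_1^{*T},\dots,p_n^{*T})^T\in\mathbb{R}^{nd}$ is a configuration forming the desired shape, $e_{ij}=p_i-p_j$, $e_{ij}^*=p_i^*-p_j^*$. The constraint set is $$\mathcal{T}_{\mathcal{G}_f}^*=\{(i,j,k)\in\mathcal{V}^3:(i,j),(i,k)\in\mathcal{E}_f,\ (j=k\text{ or }(j,k)\in\mathcal{E}_s),\ j\leq k\}.$$ Let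 $r_{\mathcal{G}_f}(p)=(\dots,e_{ij}^Te_{ik},\dots)^T$, $(i,j,k)\in\mathcal{T}_{\mathcal{G}_f}^*$, and $R_w(p)=\frac{\partial r_{\mathcal{G}_f}}{\partial p}$. The framework $(\mathcal{G}_f,p^* )$ with $\mathcal{T}_{\mathcal{G}_f}^*$ is infinitesimally weakly rigid if $\mathrm{rank}(R_w(p^* ))=nd-d(d+1)/2$. In compact form the closed-loop system is $\dot p=-R_w^T(p)\,(r_{\mathcal{G}_f}(p)-r_{\mathcal{G}_f}(p^* ))$. A set $M$ is locally exponentially stable if there exists an exponent $c>0$ such that for any $x\in M$ there exists a neighborhood $\Omega$ of $x$ such that any trajectory starting from $\Omega$ converges to $M$ at least as fast as $e^{-ct}$. *)

theory Defs
  imports "HOL-Analysis.Analysis"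
begin

section \<open>Frameworks\<close>

text \<open>
  The agents are the elements of a finite linearly ordered type \<open>'n\<close>, standing for
  \<open>{1, \<dots>, n}\<close> with \<open>n = CARD('n)\<close>, and \<open>d = CARD('d)\<close>. The stacked state space \<open>\<real>\<^sup>n\<^sup>d\<close> is
  \<open>real ^ ('n \<times> 'd)\<close>; the block \<open>p\<^sub>i\<close> of a state is \<open>agent p i\<close>. A simple undirected graph on
  the agents is given by its symmetric and irreflexive adjacency relation.
\<close>

definition simple_graph :: "'n rel \<Rightarrow> bool" where
  "simple_graph E \<longleftrightarrow> sym E \<and> irrefl E"

definition agent :: "real ^ ('n::finite \<times> 'd::finite) \<Rightarrow> 'n \<Rightarrow> real ^ 'd" where
  "agent p i = (\<chi> a. p $ (i, a))"

definition stack :: "('n::finite \<Rightarrow> real ^ 'd::finite) \<Rightarrow> real ^ ('n \<times> 'd)" where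
  "stack q = (\<chi> x. q (fst x) $ snd x)"

lemma agent_stack [simp]: "agent (stack q) i = q i"
  by (simp add: agent_def stack_def vec_eq_iff)

lemma stack_agent [simp]: "stack (agent p) = p"
  by (simp add: agent_def stack_def vec_eq_iff)

definition edge_vec :: "real ^ ('n::finite \<times> 'd::finite) \<Rightarrow> 'n \<Rightarrow> 'n \<Rightarrow> real ^ 'd" where
  "edge_vec p i j = agent p i - agent p j"

definition constraint_set :: "'n::linorder rel \<Rightarrow> 'n rel \<Rightarrow> ('n \<times> 'n \<times> 'n) set" where
  "constraint_set Ef Es =
     {(i, j, k). (i, j) \<in> Ef \<and> (i, k) \<in> Ef \<and> (j = k \<or> (j, k) \<in> Es) \<and> j \<le> k}"

text \<open>
  The rigidity function has one component for each triple of vertices; those outside the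
  constraint set are identically zero. They only add zero rows to the Jacobian matrix and so
  do not affect its rank.
\<close>

definition rigidity_fun ::
  "'n::{finite,linorder} rel \<Rightarrow> 'n rel \<Rightarrow> real ^ ('n \<times> 'd::finite) \<Rightarrow> real ^ ('n \<times> 'n \<times> 'n)" where
  "rigidity_fun Ef Es p =
     (\<chi> x. case x of (i, j, k) \<Rightarrow>
        if (i, j, k) \<in> constraint_set Ef Es then edge_vec p i j \<bullet> edge_vec p i k else 0)"

definition rigidity_matrix ::
  "'n::{finite,linorder} rel \<Rightarrow> 'n rel \<Rightarrow> real ^ ('n \<times> 'd::finite)
     \<Rightarrow> real ^ ('n \<times> 'd) ^ ('n \<times> 'n \<times> 'n)" where
  "rigidity_matrix Ef Es p = jacobian (rigidity_fun Ef Es) (at p)"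

definition infinitesimally_weakly_rigid ::
  "'n::{finite,linorder} rel \<Rightarrow> 'n rel \<Rightarrow> real ^ ('n \<times> 'd::finite) \<Rightarrow> bool" where
  "infinitesimally_weakly_rigid Ef Es p \<longleftrightarrow>
     real (rank (rigidity_matrix Ef Es p)) =
       real CARD('n) * real CARD('d) - real CARD('d) * (real CARD('d) + 1) / 2"

section \<open>The gradient control law\<close>

definition gradient :: "('a::real_inner \<Rightarrow> real) \<Rightarrow> 'a \<Rightarrow> 'a" where
  "gradient f x = (THE D. GDERIV f x :> D)"

lemma gradient_eqI:
  assumes "GDERIV f x :> D"
  shows "gradient f x = D"
  unfolding gradient_def
proof (rule the_equality)
  fix D'
  assume "GDERIV f x :> D'"
  then have "(\<lambda>h. h \<bullet> D') = (\<lambda>h. h \<bullet> D)"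
    using assms has_derivative_unique[of f "\<lambda>h. h \<bullet> D'" x "\<lambda>h. h \<bullet> D"]
    by (simp only: gderiv_def)
  then have "(D' - D) \<bullet> D' = (D' - D) \<bullet> D"
    by (rule fun_cong)
  then have "(D' - D) \<bullet> (D' - D) = 0"
    by (simp only: inner_diff_right)
  then show "D' = D"
    by simp
qed (fact assms)

definition potential ::
  "'n::{finite,linorder} rel \<Rightarrow> 'n rel \<Rightarrow> real ^ ('n \<times> 'd::finite) \<Rightarrow> real ^ ('n \<times> 'd) \<Rightarrow> real" where
  "potential Ef Es pstar p =
     1 / 2 * (\<Sum>(i, j, k) \<in> constraint_set Ef Es.
       (edge_vec p i j \<bullet> edge_vec p i k - edge_vec pstar i j \<bullet> edge_vec pstar i k)\<^sup>2)"

text \<open>The gradient of \<open>V\<close> with respect to the position of agent \<open>i\<close>, the others being fixed.\<close>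

definition agent_gradient ::
  "(real ^ ('n::finite \<times> 'd::finite) \<Rightarrow> real) \<Rightarrow> 'n \<Rightarrow> real ^ ('n \<times> 'd) \<Rightarrow> real ^ 'd" where
  "agent_gradient V i p = gradient (\<lambda>x. V (stack ((agent p)(i := x)))) (agent p i)"

definition control ::
  "'n::{finite,linorder} rel \<Rightarrow> 'n rel \<Rightarrow> real ^ ('n \<times> 'd::finite) \<Rightarrow> 'n \<Rightarrow> real ^ ('n \<times> 'd) \<Rightarrow> real ^ 'd" where
  "control Ef Es pstar i p = - agent_gradient (potential Ef Es pstar) i p"

definition closed_loop ::
  "'n::{finite,linorder} rel \<Rightarrow> 'n rel \<Rightarrow> real ^ ('n \<times> 'd::finite) \<Rightarrow> real ^ ('n \<times> 'd) \<Rightarrow> real ^ ('n \<times> 'd)" where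
  "closed_loop Ef Es pstar p = stack (\<lambda>i. control Ef Es pstar i p)"

definition target_set :: "real ^ ('n::finite \<times> 'd::finite) \<Rightarrow> (real ^ ('n \<times> 'd)) set" where
  "target_set pstar =
     {p. \<forall>i j k. (agent p i - agent p j) \<bullet> (agent p i - agent p k) =
        (agent pstar i - agent pstar j) \<bullet> (agent pstar i - agent pstar k)}"

section \<open>Local exponential stability of a set\<close>

definition trajectory :: "('a::real_normed_vector \<Rightarrow> 'a) \<Rightarrow> real set \<Rightarrow> (real \<Rightarrow> 'a) \<Rightarrow> bool" where
  "trajectory f I \<phi> \<longleftrightarrow>
     is_interval I \<and> 0 \<in> I \<and> I \<subseteq> {0..} \<and>
     (\<forall>t\<in>I. (\<phi> has_vector_derivative f (\<phi> t)) (at t within I))"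

text \<open>
  The exponent \<open>c\<close> is common to all points of \<open>M\<close>, whereas the neighbourhood and the constant
  \<open>C\<close> of the exponential bound depend on the point. Trajectories are taken on
  any forward time interval, so that the bound for \<open>I = {0..}\<close> is exponential convergence
  to \<open>M\<close> and a solution that is only defined on a shorter interval is not exempted
  from it.
\<close>

definition locally_exponentially_stable ::
  "('a::real_normed_vector \<Rightarrow> 'a) \<Rightarrow> 'a set \<Rightarrow> bool" where
  "locally_exponentially_stable f M \<longleftrightarrow>
     (\<exists>c>0. \<forall>x\<in>M. \<exists>\<Omega> C. open \<Omega> \<and> x \<in> \<Omega> \<and>
        (\<forall>I \<phi>. trajectory f I \<phi> \<and> \<phi> 0 \<in> \<Omega> \<longrightarrow>
           (\<forall>t\<in>I. infdist (\<phi> t) M \<le> C * exp (- c * t))))"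

end

theory Submission
  imports Defs
begin

text \<open>
  Let \<open>y\<close> be a point of the target set nearest to the state \<open>p\<close>, and \<open>h = p - y\<close>. All points of
  the target set are congruent, so an isometry moves \<open>y\<close> to \<open>p\<^sup>*\<close>; minimality makes \<open>h\<close>
  orthogonal to the infinitesimal rigid motions there. The rank hypothesis and a dimension count
  show that \<open>p\<^sup>*\<close> affinely spans the space and that these motions are the whole kernel of
  \<open>R\<^sub>w(p\<^sup>*)\<close>, so \<open>|R\<^sub>w(y) h| \<ge> \<sigma> |h|\<close> with \<open>\<sigma> > 0\<close> independent of \<open>y\<close>. As \<open>r\<close> is quadratic,
  \<open>h \<bullet> \<nabla>V(p) \<ge> const |h|\<^sup>2\<close> on a uniform tube around the target set. Since the distance at a later
  time is at most the distance to the same \<open>y\<close>, the squared distance to the target set decays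
  exponentially along trajectories.
\<close>

section \<open>Exponential decay of the distance to a set\<close>

text \<open>A continuity argument: if \<open>u t * exp (a * t)\<close> exceeded a level above
  \<open>u 0\<close>, the local decrease, applied at the last earlier time where that level is not
  exceeded, would produce a still later such time.\<close>

lemma exponential_bound_of_local_decrease:
  fixes u :: "real \<Rightarrow> real"
  assumes cont: "continuous_on {0..T} u" and nonneg: "0 \<le> u 0" and less: "u 0 < D" and a: "0 \<le> a"
    and dec: "\<And>t. 0 \<le> t \<Longrightarrow> t < T \<Longrightarrow> 0 < u t \<Longrightarrow> u t < D \<Longrightarrow>
      \<exists>\<eta>>0. \<forall>s. 0 < s \<longrightarrow> s < \<eta> \<longrightarrow> t + s \<le> T \<longrightarrow> u (t + s) < u t * exp (- a * s)"
    and t: "0 \<le> t" "t \<le> T"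
  shows "u t \<le> u 0 * exp (- a * t)"
proof -
  define w where "w t = u t * exp (a * t)" for t
  have contw: "continuous_on {0..T} w"
    unfolding w_def by (intro continuous_intros cont)
  \<comment> \<open>Levels \<open>K\<close> strictly above \<open>u 0\<close> force \<open>u\<close>
    to be positive at the crossing time, even if \<open>u 0 = 0\<close>; \<open>dec\<close> says
    nothing where \<open>u\<close> vanishes.\<close>
  have w_le: "w t \<le> K" if K: "u 0 < K" "K < D" for K
  proof (rule ccontr)
    assume "\<not> w t \<le> K"
    then have wt: "K < w t" by simp
    define S where "S = {s \<in> {0..t}. w s \<le> K}"
    have "closed S"
      unfolding S_def
      using continuous_on_subset[OF contw, of "{0..t}"] t
      by (intro continuous_on_closed_Collect_le continuous_on_const) auto
    then have "compact S"
      by (metis (no_types, lifting) S_def bounded_closed_interval bounded_subset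
          compact_eq_bounded_closed mem_Collect_eq subsetI)
    moreover have "0 \<in> S"
      using t K by (simp add: S_def w_def)
    ultimately obtain \<tau> where \<tau>: "\<tau> \<in> S" "\<And>s. s \<in> S \<Longrightarrow> s \<le> \<tau>"
      using compact_attains_sup[of S] by blast
    have \<tau>t: "0 \<le> \<tau>" "\<tau> < t" "w \<tau> \<le> K"
      using \<tau>(1) wt by (auto simp: S_def order_less_le)
    obtain s where s: "\<tau> \<le> s" "s \<le> t" "w s = K"
      using IVT'[of w \<tau> K t] \<tau>t wt continuous_on_subset[OF contw, of "{\<tau>..t}"] t by auto
    then have "s \<in> S"
      using \<tau>t(1) by (simp add: S_def)
    then have w\<tau>: "w \<tau> = K"
      using \<tau>(2)[of s] s by simp
    have u\<tau>: "u \<tau> = K * exp (- a * \<tau>)"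
      using w\<tau> by (simp add: w_def exp_minus field_simps)
    have Kpos: "0 < K"
      using K nonneg by linarith
    have "u \<tau> \<le> K"
      unfolding u\<tau> using Kpos a \<tau>t(1) by (simp add: mult_left_le)
    then have "u \<tau> < D"
      using K by simp
    moreover have "0 < u \<tau>"
      using Kpos by (simp add: u\<tau>)
    ultimately obtain \<eta> where \<eta>: "\<eta> > 0"
      "\<And>s. 0 < s \<Longrightarrow> s < \<eta> \<Longrightarrow> \<tau> + s \<le> T \<Longrightarrow> u (\<tau> + s) < u \<tau> * exp (- a * s)"
      using dec[of \<tau>] \<tau>t t \<open>0 < u \<tau>\<close> \<open>u \<tau> < D\<close> by auto
    define s where "s = min (\<eta> / 2) (t - \<tau>)"
    have s: "0 < s" "s < \<eta>" "\<tau> + s \<le> t"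
      using \<eta>(1) \<tau>t by (auto simp: s_def min_def)
    have "u (\<tau> + s) < K * exp (- a * \<tau>) * exp (- a * s)"
      using \<eta>(2)[of s] s t u\<tau> by simp
    also have "\<dots> = K * exp (- (a * (\<tau> + s)))"
      by (simp add: exp_add[symmetric] algebra_simps)
    finally have "w (\<tau> + s) < K"
      by (simp add: w_def exp_minus divide_inverse[symmetric] pos_less_divide_eq)
    then have "\<tau> + s \<in> S"
      using s \<tau>t by (simp add: S_def)
    then show False
      using \<tau>(2) s by force
  qed
  have "w t \<le> u 0"
  proof (rule field_le_epsilon)
    fix e :: real assume "0 < e"
    define e' where "e' = min e ((D - u 0) / 2)"
    have "0 < e'"
      using \<open>0 < e\<close> less by (simp add: e'_def)
    moreover have "e' \<le> e" "e' \<le> (D - u 0) / 2"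
      unfolding e'_def by (rule min.cobounded1, rule min.cobounded2)
    moreover have "(D - u 0) / 2 < D - u 0"
      using less by (simp add: field_simps)
    ultimately show "w t \<le> u 0 + e"
      using w_le[of "u 0 + e'"] by linarith
  qed
  then show ?thesis
    by (simp add: w_def exp_minus field_simps)
qed

text \<open>The distance to \<open>M\<close> need not be differentiable, but at each time the
  current nearest point can be frozen: the squared distance to that fixed point is differentiable,
  agrees with the squared distance to \<open>M\<close> now and bounds it from above later.\<close>

lemma locally_exponentially_stable_of_nearest_point:
  fixes f :: "'a::euclidean_space \<Rightarrow> 'a"
  assumes M: "closed M" and pos: "0 < \<delta>" "0 < \<kappa>"
    and decay: "\<And>p y. y \<in> M \<Longrightarrow> infdist p M = dist p y \<Longrightarrow> dist p y < \<delta> \<Longrightarrow>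
      (p - y) \<bullet> f p \<le> - \<kappa> * (norm (p - y))\<^sup>2"
  shows "locally_exponentially_stable f M"
  unfolding locally_exponentially_stable_def
proof (intro exI[of _ "\<kappa> / 2"] conjI ballI)
  show "0 < \<kappa> / 2" using pos by simp
  fix x assume x: "x \<in> M"
  then have ne: "M \<noteq> {}" by auto
  have bound: "infdist (\<phi> t) M \<le> \<delta> * exp (- (\<kappa> / 2) * t)"
    if tr: "trajectory f I \<phi>" and start: "\<phi> 0 \<in> ball x \<delta>" and tI: "t \<in> I" for I \<phi> t
  proof -
    define u where "u s = (infdist (\<phi> s) M)\<^sup>2" for s
    have I: "is_interval I" "0 \<in> I" "t \<ge> 0"
      and der: "\<And>s. s \<in> I \<Longrightarrow> (\<phi> has_vector_derivative f (\<phi> s)) (at s within I)"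
      using tr tI by (auto simp: trajectory_def)
    have sub: "{0..t} \<subseteq> I"
      using I(1,2) tI by (meson atLeastAtMost_iff is_interval_1 subsetI)
    have contI: "continuous_on I \<phi>"
      using der by (meson continuous_on_vector_derivative)
    have cont: "continuous_on {0..t} u"
      unfolding u_def
      by (intro continuous_intros continuous_on_subset[OF contI sub])
    have "infdist (\<phi> 0) M < \<delta>"
      using start infdist_le[OF x, of "\<phi> 0"] by (simp add: dist_commute)
    then have u0: "u 0 < \<delta>\<^sup>2"
      unfolding u_def by (simp add: infdist_nonneg power_strict_mono)
    have dec: "\<exists>\<eta>>0. \<forall>h. 0 < h \<longrightarrow> h < \<eta> \<longrightarrow> s + h \<le> t \<longrightarrow> u (s + h) < u s * exp (- \<kappa> * h)"
      if s: "0 \<le> s" "s < t" "0 < u s" "u s < \<delta>\<^sup>2" for s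
    proof -
      obtain y where y: "y \<in> M" "infdist (\<phi> s) M = dist (\<phi> s) y"
        using infdist_attains_inf[OF M ne] by blast
      have us: "u s = (norm (\<phi> s - y))\<^sup>2"
        by (simp add: u_def y(2) dist_norm)
      have "dist (\<phi> s) y < \<delta>"
        using s(4) pos(1) unfolding u_def y(2) by (meson less_imp_le power_less_imp_less_base)
      then have dk: "(\<phi> s - y) \<bullet> f (\<phi> s) \<le> - \<kappa> * u s"
        using decay[OF y] us by simp
      \<comment> \<open>The squared distance to \<open>y\<close> has derivative at most
        \<open>- 2 * \<kappa> * u s\<close> at \<open>s\<close>. Comparing with the slower rate
        \<kappa> leaves a strictly negative derivative; the final square root halves the rate to
        \<open>\<kappa> / 2\<close>.\<close>
      define \<psi> where "\<psi> r = (norm (\<phi> r - y))\<^sup>2 - u s * exp (- \<kappa> * (r - s))" for r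
      have \<psi>: "\<psi> r = (\<phi> r - y) \<bullet> (\<phi> r - y) - u s * exp (- \<kappa> * (r - s))" for r
        by (simp add: \<psi>_def dot_square_norm)
      have d1: "(\<phi> has_derivative (\<lambda>r. r *\<^sub>R f (\<phi> s))) (at s within {0..t})"
        using der[of s] sub s has_vector_derivative_within_subset
        by (metis atLeastAtMost_iff has_vector_derivative_def in_mono less_imp_le)
      have "((\<lambda>r. (\<phi> r - y) \<bullet> (\<phi> r - y)) has_derivative
          (\<lambda>r. (\<phi> s - y) \<bullet> (r *\<^sub>R f (\<phi> s) - 0) + (r *\<^sub>R f (\<phi> s) - 0) \<bullet> (\<phi> s - y))) (at s within {0..t})"
        by (intro has_derivative_inner has_derivative_diff d1 has_derivative_const)
      then have "((\<lambda>r. (\<phi> r - y) \<bullet> (\<phi> r - y)) has_real_derivative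
          2 * ((\<phi> s - y) \<bullet> f (\<phi> s))) (at s within {0..t})"
        unfolding has_field_derivative_def
        by (rule has_derivative_eq_rhs) (auto simp: inner_commute)
      then have "(\<psi> has_real_derivative (2 * ((\<phi> s - y) \<bullet> f (\<phi> s)) + \<kappa> * u s)) (at s within {0..t})"
        unfolding \<psi> by (auto intro!: derivative_eq_intros)
      moreover have "0 < \<kappa> * u s"
        using pos s by simp
      then have "2 * ((\<phi> s - y) \<bullet> f (\<phi> s)) + \<kappa> * u s < 0"
        using dk by linarith
      ultimately obtain d where d: "d > 0"
        "\<And>h. 0 < h \<Longrightarrow> s + h \<in> {0..t} \<Longrightarrow> h < d \<Longrightarrow> \<psi> (s + h) < \<psi> s"
        by (meson has_real_derivative_neg_dec_right)
      have "u (s + h) < u s * exp (- \<kappa> * h)" if h: "0 < h" "h < d" "s + h \<le> t" for h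
      proof -
        have "\<psi> (s + h) < 0"
          using d(2)[of h] h s by (simp add: \<psi>_def us)
        moreover have "u (s + h) \<le> (norm (\<phi> (s + h) - y))\<^sup>2"
          unfolding u_def using infdist_le[OF y(1), of "\<phi> (s + h)"]
          by (simp add: dist_norm infdist_nonneg power_mono)
        ultimately show ?thesis
          by (simp add: \<psi>_def)
      qed
      then show ?thesis
        using d(1) by blast
    qed
    have "u t \<le> u 0 * exp (- \<kappa> * t)"
      by (rule exponential_bound_of_local_decrease[where D = "\<delta>\<^sup>2" and T = t])
        (use cont u0 pos dec I in \<open>auto simp: u_def\<close>)
    also have "\<dots> \<le> \<delta>\<^sup>2 * exp (- \<kappa> * t)"
      using u0 by (intro mult_right_mono) auto
    also have "\<dots> = (\<delta> * exp (- (\<kappa> / 2) * t))\<^sup>2"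
      by (simp add: power_mult_distrib exp_double[symmetric])
    finally show ?thesis
      unfolding u_def using pos by (meson exp_ge_zero less_imp_le mult_nonneg_nonneg power2_le_imp_le)
  qed
  show "\<exists>\<Omega> C. open \<Omega> \<and> x \<in> \<Omega> \<and> (\<forall>I \<phi>. trajectory f I \<phi> \<and> \<phi> 0 \<in> \<Omega> \<longrightarrow>
      (\<forall>t\<in>I. infdist (\<phi> t) M \<le> C * exp (- (\<kappa> / 2) * t)))"
    by (rule exI[of _ "ball x \<delta>"], rule exI[of _ \<delta>]) (use pos bound in auto)
qed

section \<open>Counting infinitesimal motions\<close>

lemma card_le_dim_orthogonal_family:
  fixes f :: "'i \<Rightarrow> 'a::euclidean_space"
  assumes "finite I" and "\<And>i. i \<in> I \<Longrightarrow> f i \<in> S" and "\<And>i. i \<in> I \<Longrightarrow> f i \<noteq> 0"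
    and "\<And>i j. i \<in> I \<Longrightarrow> j \<in> I \<Longrightarrow> i \<noteq> j \<Longrightarrow> f i \<bullet> f j = 0"
  shows "card I \<le> dim S"
proof -
  have inj: "inj_on f I"
    using assms(3,4) by (metis inj_onI inner_eq_zero_iff)
  have "pairwise orthogonal (f ` I)"
    using assms(4) by (fastforce simp: pairwise_def orthogonal_def)
  moreover have "0 \<notin> f ` I"
    using assms(3) by auto
  ultimately have "independent (f ` I)"
    by (rule pairwise_orthogonal_independent)
  moreover have "f ` I \<subseteq> S"
    using assms(2) by auto
  ultimately have "card (f ` I) \<le> dim S"
    by (simp add: independent_card_le_dim)
  then show ?thesis
    by (simp add: card_image inj)
qed

text \<open>\<open>Q\<close> is prescribed on a basis chosen among the vectors \<open>a i\<close>.
  The Gram equalities pass from that basis to all vectors by linearity in one argument at a time, so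
  \<open>Q\<close> preserves inner products and \<open>b i - Q (a i)\<close> has norm zero.\<close>

lemma isometry_of_equal_inner_products:
  fixes a b :: "'i \<Rightarrow> 'a::euclidean_space"
  assumes gram: "\<And>i j. b i \<bullet> b j = a i \<bullet> a j" and span: "span (range a) = UNIV"
  obtains Q where "orthogonal_transformation Q" and "\<And>i. b i = Q (a i)"
proof -
  obtain B where B: "B \<subseteq> range a" "independent B" "range a \<subseteq> span B"
    using maximal_independent_subset by blast
  have spanB: "span B = UNIV"
    using B(3) span by (metis span_minimal subspace_span top.extremum_unique)
  define idx where "idx x = (SOME i. a i = x)" for x
  have idx: "a (idx x) = x" if "x \<in> B" for x
    using that B(1) unfolding idx_def by (metis (mono_tags, lifting) image_iff someI subsetD)
  obtain Q where Q: "linear Q" "\<And>x. x \<in> B \<Longrightarrow> Q x = b (idx x)"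
    using linear_independent_extend[OF B(2), of "\<lambda>x. b (idx x)"] by blast
  have Qb: "Q x \<bullet> b k = x \<bullet> a k" for x k
  proof (rule linear_eq_on_span[where f = "\<lambda>x. Q x \<bullet> b k" and B = B])
    show "linear (\<lambda>x. Q x \<bullet> b k)" "linear (\<lambda>x. x \<bullet> a k)"
      using Q(1) by (auto simp: linear_iff inner_add_left)
    show "x \<in> span B"
      by (simp add: spanB)
    show "Q x \<bullet> b k = x \<bullet> a k" if "x \<in> B" for x
      using that by (simp add: Q(2) gram idx)
  qed
  have QQ: "Q x \<bullet> Q y = x \<bullet> y" for x y
  proof (rule linear_eq_on_span[where f = "\<lambda>y. Q x \<bullet> Q y" and B = B])
    show "linear (\<lambda>y. Q x \<bullet> Q y)" "linear (\<lambda>y. x \<bullet> y)"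
      using Q(1) by (auto simp: linear_iff inner_add_right)
    show "y \<in> span B"
      by (simp add: spanB)
    show "Q x \<bullet> Q y = x \<bullet> y" if "y \<in> B" for y
      using that by (simp add: Q(2) Qb idx)
  qed
  have "b i = Q (a i)" for i
  proof -
    have "(b i - Q (a i)) \<bullet> (b i - Q (a i)) = 0"
      by (simp add: inner_diff_left inner_diff_right Qb QQ gram inner_commute[of "b i" "Q _"])
    then show ?thesis
      by simp
  qed
  moreover have "orthogonal_transformation Q"
    by (simp add: orthogonal_transformation_def Q(1) QQ)
  ultimately show thesis
    using that by blast
qed

section \<open>Skew-symmetric matrices as infinitesimal rotations\<close>

definition outer :: "real ^ 'd \<Rightarrow> real ^ 'd \<Rightarrow> real ^ 'd ^ 'd" where
  "outer x y = (\<chi> a b. x $ a * y $ b)"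

lemma inner_outer:
  fixes x y u v :: "real ^ 'd::finite"
  shows "outer x y \<bullet> outer u v = (x \<bullet> u) * (y \<bullet> v)"
  by (simp add: outer_def inner_vec_def sum_product mult.commute mult.left_commute)

lemma outer_mult_vec:
  fixes x y v :: "real ^ 'd::finite"
  shows "outer x y *v v = (y \<bullet> v) *\<^sub>R x"
  by (simp add: outer_def matrix_vector_mult_def vec_eq_iff inner_vec_def sum_distrib_left sum_distrib_right mult_ac)

lemma transpose_outer: "transpose (outer x y) = outer y x"
  by (simp add: outer_def transpose_def vec_eq_iff)

lemma transpose_diff: "transpose (A - B) = transpose A - transpose (B :: real ^ 'm ^ 'n)"
  by (simp add: transpose_def vec_eq_iff)

text \<open>Skewness makes such a matrix vanish on the orthogonal complement of \<open>W\<close>, so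
  for a subspace this is a copy of the Lie algebra so(W) of infinitesimal rotations within
  \<open>W\<close>.\<close>

definition skew_maps_into :: "(real ^ 'd::finite) set \<Rightarrow> (real ^ 'd ^ 'd) set" where
  "skew_maps_into W = {A. transpose A = - A \<and> (\<forall>x. A *v x \<in> W)}"

lemma subspace_skew_maps_into:
  assumes "subspace W"
  shows "subspace (skew_maps_into W)"
proof (rule subspaceI)
  show "0 \<in> skew_maps_into W"
    using assms by (simp add: skew_maps_into_def subspace_0 transpose_def vec_eq_iff)
next
  fix A B assume "A \<in> skew_maps_into W" "B \<in> skew_maps_into W"
  moreover have "transpose (A + B) = transpose A + transpose B"
    by (simp add: transpose_def vec_eq_iff)
  ultimately show "A + B \<in> skew_maps_into W"
    using assms by (simp add: skew_maps_into_def matrix_vector_mult_add_rdistrib subspace_add)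
next
  fix A and c :: real assume "A \<in> skew_maps_into W"
  moreover have "transpose (c *\<^sub>R A) = c *\<^sub>R transpose A"
    by (simp add: transpose_def vec_eq_iff)
  ultimately show "c *\<^sub>R A \<in> skew_maps_into W"
    using assms
    by (simp add: skew_maps_into_def scaleR_matrix_vector_assoc[symmetric] subspace_scale)
qed

lemma inner_skew:
  fixes A :: "real ^ 'd::finite ^ 'd"
  assumes "transpose A = - A"
  shows "(A *v x) \<bullet> y = - (x \<bullet> (A *v y))"
proof -
  have "(A *v x) \<bullet> y = x \<bullet> (transpose A *v y)"
    by (metis dot_lmul_matrix inner_commute transpose_matrix_vector)
  also have "\<dots> = - (x \<bullet> (A *v y))"
    unfolding assms
    by (simp add: inner_vec_def matrix_vector_mult_def sum_negf)
  finally show ?thesis .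
qed

text \<open>For an orthonormal basis of \<open>W\<close>, the matrices b_i b_j^T - b_j b_i^T with i
  < j are pairwise orthogonal with squared norm 2; there is one for each unordered pair.\<close>

lemma dim_skew_maps_into:
  fixes W :: "(real ^ 'd::finite) set"
  assumes W: "subspace W"
  shows "dim W * (dim W - 1) div 2 \<le> dim (skew_maps_into W)"
proof -
  obtain B where B: "B \<subseteq> W" "pairwise orthogonal B" "\<And>x. x \<in> B \<Longrightarrow> norm x = 1" "independent B"
      "card B = dim W"
    using orthonormal_basis_subspace[OF W] by metis
  obtain b where b: "bij_betw b {0..<dim W} B"
    using ex_bij_betw_nat_finite[of B] independent_imp_finite[OF B(4)] B(5) by metis
  have bW: "b i \<in> W" if "i < dim W" for i
    using that b B(1) by (auto simp: bij_betw_def)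
  have bb: "b i \<bullet> b j = (if i = j then 1 else 0)" if "i < dim W" "j < dim W" for i j
  proof -
    have "b i \<in> B" "b j \<in> B"
      using that b by (auto simp: bij_betw_def)
    moreover have "b i = b j \<Longrightarrow> i = j"
      using that b by (auto simp: bij_betw_def inj_on_def)
    ultimately show ?thesis
      using B(2,3) by (auto simp: pairwise_def orthogonal_def dot_square_norm)
  qed
  define I where "I = (SIGMA j:{..<dim W}. {..<j})"
  define M where "M x = (case x of (j, i) \<Rightarrow> outer (b i) (b j) - outer (b j) (b i))" for x
  have MM: "M (j, i) \<bullet> M (l, k) = (if i = k \<and> j = l then 2 else 0)"
    if "(j, i) \<in> I" "(l, k) \<in> I" for i j k l
    using that by (auto simp: M_def I_def inner_diff_left inner_diff_right inner_outer bb)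
  have "card I \<le> dim (skew_maps_into W)"
  proof (rule card_le_dim_orthogonal_family)
    show "finite I"
      by (simp add: I_def)
    show "M x \<in> skew_maps_into W" if "x \<in> I" for x
      using that W bW
      by (auto simp: I_def M_def skew_maps_into_def transpose_diff transpose_outer
          matrix_vector_mult_diff_rdistrib outer_mult_vec intro!: subspace_diff subspace_scale)
    show "M x \<noteq> 0" if "x \<in> I" for x
      using MM[of "fst x" "snd x" "fst x" "snd x"] that by auto
    show "M x \<bullet> M y = 0" if "x \<in> I" "y \<in> I" "x \<noteq> y" for x y
      using MM[of "fst x" "snd x" "fst y" "snd y"] that by (auto simp: prod_eq_iff split: if_splits)
  qed
  moreover have "card I = (\<Sum>j<dim W. j)"
    by (simp add: I_def)
  moreover have "(\<Sum>j<n. j) = n * (n - 1) div 2" for n :: nat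
    by (metis Sum_Ico_nat diff_zero lessThan_atLeast0 mult_0 )
  ultimately show ?thesis
    by simp
qed

section \<open>Block structure of the stacked state space\<close>

lemma inner_stack: "x \<bullet> y = (\<Sum>i\<in>UNIV. agent x i \<bullet> agent y i)"
  by (simp add: inner_vec_def agent_def sum.cartesian_product UNIV_Times_UNIV[symmetric]
      split_def del: UNIV_Times_UNIV)

text \<open>Placing each vector of an orthonormal basis of \<open>U\<close> in each single block,
  with zeros elsewhere, gives an orthogonal family of this size.\<close>

lemma dim_blockwise:
  fixes U :: "(real ^ 'd::finite) set"
  assumes U: "subspace U"
  shows "CARD('n) * dim U \<le> dim {z :: real ^ ('n::finite \<times> 'd). \<forall>i. agent z i \<in> U}"
proof -
  obtain C where C: "C \<subseteq> U" "pairwise orthogonal C" "\<And>x. x \<in> C \<Longrightarrow> norm x = 1" "independent C"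
      "card C = dim U"
    using orthonormal_basis_subspace[OF U] by metis
  have finC: "finite C"
    using C(4) independent_imp_finite by blast
  have inn: "stack ((\<lambda>_. 0)(i := w)) \<bullet> stack ((\<lambda>_. 0)(j := w')) = (if i = j then w \<bullet> w' else 0)"
    for i j :: 'n and w w' :: "real ^ 'd"
  proof -
    have "stack ((\<lambda>_. 0)(i := w)) \<bullet> stack ((\<lambda>_. 0)(j := w')) =
        (\<Sum>k\<in>UNIV. if k = i then if i = j then w \<bullet> w' else 0 else 0)"
      unfolding inner_stack agent_stack by (intro sum.cong) auto
    then show ?thesis
      by simp
  qed
  have "card ((UNIV :: 'n set) \<times> C) \<le> dim {z :: real ^ ('n \<times> 'd). \<forall>i. agent z i \<in> U}"
  proof (rule card_le_dim_orthogonal_family[where f = "\<lambda>x. stack ((\<lambda>_. 0)(fst x := snd x))"])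
    show "finite ((UNIV :: 'n set) \<times> C)"
      by (simp add: finC)
    show "stack ((\<lambda>_. 0)(fst x := snd x)) \<in> {z. \<forall>i. agent z i \<in> U}"
      if "x \<in> UNIV \<times> C" for x :: "'n \<times> (real ^ 'd)"
      using that C(1) subspace_0[OF U] by auto
    show "stack ((\<lambda>_. 0)(fst x := snd x)) \<noteq> 0" if "x \<in> UNIV \<times> C" for x :: "'n \<times> (real ^ 'd)"
    proof
      assume "stack ((\<lambda>_. 0)(fst x := snd x)) = 0"
      then have "snd x \<bullet> snd x = 0"
        using inn[of "fst x" "snd x" "fst x" "snd x"] by simp
      then show False
        using C(3)[of "snd x"] that by auto
    qed
    show "stack ((\<lambda>_. 0)(fst x := snd x)) \<bullet> stack ((\<lambda>_. 0)(fst y := snd y)) = 0"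
      if "x \<in> UNIV \<times> C" "y \<in> UNIV \<times> C" "x \<noteq> y" for x y :: "'n \<times> (real ^ 'd)"
      using that C(2) by (auto simp: inn pairwise_def orthogonal_def prod_eq_iff)
  qed
  then show ?thesis
    by (simp add: card_cartesian_product C(5))
qed

lemma linear_agent: "linear (\<lambda>p. agent p i)"
  by (simp add: linear_iff agent_def vec_eq_iff)

lemma linear_edge_vec: "linear (\<lambda>p. edge_vec p i j)"
  unfolding edge_vec_def by (intro linear_compose_sub linear_agent)

lemmas agent_add = linear_add[OF linear_agent]
  and agent_diff = linear_diff[OF linear_agent]
  and agent_scaleR = linear_scale[OF linear_agent]
  and edge_vec_add = linear_add[OF linear_edge_vec]
  and edge_vec_diff = linear_diff[OF linear_edge_vec]
  and edge_vec_scaleR = linear_scale[OF linear_edge_vec]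

lemma agent_zero [simp]: "agent 0 i = 0"
  by (rule linear_0[OF linear_agent])

lemma eq_if_agent_eq: "(\<And>i. agent p i = agent q i) \<Longrightarrow> p = q"
  by (metis ext stack_agent)

lemma norm_agent_le: "norm (agent p i) \<le> norm p"
proof -
  have "agent p i \<bullet> agent p i \<le> p \<bullet> p"
    unfolding inner_stack by (rule member_le_sum) auto
  then show ?thesis
    by (simp add: norm_le)
qed

lemma norm_edge_vec_le: "norm (edge_vec p i j) \<le> 2 * norm p"
  using norm_triangle_ineq4[of "agent p i" "agent p j"] norm_agent_le[of p i] norm_agent_le[of p j]
  unfolding edge_vec_def by linarith

section \<open>Gram entries, their derivatives and the rigidity matrix\<close>

definition gram_entry :: "real ^ ('n::finite \<times> 'd::finite) \<Rightarrow> 'n \<times> 'n \<times> 'n \<Rightarrow> real" where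
  "gram_entry p x = (case x of (i, j, k) \<Rightarrow> edge_vec p i j \<bullet> edge_vec p i k)"

definition gram_deriv ::
  "real ^ ('n::finite \<times> 'd::finite) \<Rightarrow> real ^ ('n \<times> 'd) \<Rightarrow> 'n \<times> 'n \<times> 'n \<Rightarrow> real" where
  "gram_deriv p v x = (case x of (i, j, k) \<Rightarrow>
     edge_vec p i j \<bullet> edge_vec v i k + edge_vec v i j \<bullet> edge_vec p i k)"

text \<open>An exact expansion: the entries are quadratic in the state, so the second-order
  remainder is the entry of the increment itself.\<close>

lemma gram_entry_add: "gram_entry (p + h) x = gram_entry p x + gram_deriv p h x + gram_entry h x"
  by (cases x) (simp add: gram_entry_def gram_deriv_def edge_vec_add inner_add_left inner_add_right)

text \<open>The derivative is linear in its base point, and Euler's identity for a quadratic form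
  turns \<open>gram_deriv h h x\<close> into twice the entry.\<close>

lemma gram_deriv_add_self: "gram_deriv (p + h) h x = gram_deriv p h x + 2 * gram_entry h x"
  by (cases x) (simp add: gram_entry_def gram_deriv_def edge_vec_add inner_add_left inner_add_right)

lemma linear_gram_deriv: "linear (\<lambda>v. gram_deriv p v x)"
  by (cases x) (simp add: linear_iff gram_deriv_def edge_vec_add edge_vec_scaleR
      inner_add_left inner_add_right algebra_simps)

lemma abs_gram_entry_le: "\<bar>gram_entry h x\<bar> \<le> 4 * (norm h)\<^sup>2"
proof -
  obtain i j k where x: "x = (i, j, k)"
    by (cases x)
  have "\<bar>gram_entry h x\<bar> \<le> norm (edge_vec h i j) * norm (edge_vec h i k)"
    by (simp add: x gram_entry_def Cauchy_Schwarz_ineq2)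
  also have "\<dots> \<le> (2 * norm h) * (2 * norm h)"
    by (intro mult_mono norm_edge_vec_le) auto
  finally show ?thesis
    by (simp add: power2_eq_square)
qed

lemma has_derivative_gram_entry:
  "((\<lambda>p. gram_entry p x) has_derivative (\<lambda>v. gram_deriv p v x)) (at p within S)"
proof -
  obtain i j k where x: "x = (i, j, k)"
    by (cases x)
  have d: "((\<lambda>p. edge_vec p i j) has_derivative (\<lambda>v. edge_vec v i j)) (at p within S)" for i j
    by (intro bounded_linear_imp_has_derivative linear_edge_vec[unfolded linear_conv_bounded_linear])
  show ?thesis
    unfolding x gram_entry_def gram_deriv_def prod.case by (intro has_derivative_inner d)
qed

text \<open>The rigidity function is differentiated component by component; uniqueness of the
  derivative then makes the action of the abstract Jacobian explicit.\<close>

lemma rigidity_matrix_mult: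
  fixes p :: "real ^ ('n::{finite,linorder} \<times> 'd::finite)"
  shows "rigidity_matrix Ef Es p *v v =
     (\<chi> x. if x \<in> constraint_set Ef Es then gram_deriv p v x else 0)"
proof -
  define D where "D v = (\<chi> x. if x \<in> constraint_set Ef Es then gram_deriv p v x else 0)" for v
  have rf: "rigidity_fun Ef Es q $ x = (if x \<in> constraint_set Ef Es then gram_entry q x else 0)"
    for q :: "real ^ ('n \<times> 'd)" and x
    by (cases x) (simp only: rigidity_fun_def gram_entry_def vec_lambda_beta prod.case)
  have der: "(rigidity_fun Ef Es has_derivative D) (at p)"
  proof (rule iffD2[OF has_derivative_componentwise_within], rule ballI)
    fix b :: "real ^ ('n \<times> 'n \<times> 'n)" assume "b \<in> Basis"
    then obtain x where "b = axis x 1"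
      by (auto simp: Basis_vec_def)
    then have "rigidity_fun Ef Es q \<bullet> b = (if x \<in> constraint_set Ef Es then gram_entry q x else 0)"
      and "D v \<bullet> b = (if x \<in> constraint_set Ef Es then gram_deriv p v x else 0)"
      for q :: "real ^ ('n \<times> 'd)" and v
      by (simp_all only: inner_axis inner_real_def mult_1_right rf D_def vec_lambda_beta)
    then show "((\<lambda>q. rigidity_fun Ef Es q \<bullet> b) has_derivative (\<lambda>v. D v \<bullet> b)) (at p)"
      using has_derivative_gram_entry[of x p] by (cases "x \<in> constraint_set Ef Es") simp_all
  qed
  then have "(rigidity_fun Ef Es has_derivative (\<lambda>v. rigidity_matrix Ef Es p *v v)) (at p)"
    unfolding rigidity_matrix_def by (rule jacobian_works[THEN iffD1, OF differentiableI])
  then have "(\<lambda>v. rigidity_matrix Ef Es p *v v) = D"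
    using der by (rule has_derivative_unique)
  then have "rigidity_matrix Ef Es p *v v = D v"
    by (rule fun_cong)
  then show ?thesis
    by (simp only: D_def)
qed

text \<open>The kernel is orthogonal to the row space, whose dimension is the rank.\<close>

lemma rank_add_dim_kernel_le:
  fixes A :: "real ^ 'm ^ 'k"
  shows "rank A + dim {v. A *v v = 0} \<le> CARD('m)"
proof -
  have "dim {v. A *v v = 0} \<le> dim {y \<in> UNIV. \<forall>x\<in>span (rows A). orthogonal x y}"
    by (intro dim_subset) (auto intro: orthogonal_commute[THEN iffD1] orthogonal_nullspace_rowspace)
  moreover have "rank A = dim (span (rows A))"
    by (metis column_rank_def columns_transpose dim_span rank_transpose)
  ultimately show ?thesis
    using dim_subspace_orthogonal_to_vectors[of "span (rows A)" UNIV] by (simp add: subspace_UNIV)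
qed

text \<open>Here \<open>m\<close> stands for the dimension of the affine hull of the agents, and the
  sum counts rotations and translations within it and free normal velocities. With
  \<open>k = d - m > 0\<close>, cancelling \<open>k\<close> leaves
  \<open>2 * n \<le> 2 * m + k + 1\<close>, against \<open>d + 1 < n\<close>.\<close>

lemma motion_count_imp_full:
  fixes d m n :: nat
  assumes "m \<le> d" and "d + 1 < n"
    and "2 * (m * (m - 1) div 2 + m + n * (d - m)) \<le> d * (d + 1)"
  shows "m = d"
proof (rule ccontr)
  assume "m \<noteq> d"
  then obtain k where k: "d = m + k" "0 < k"
    using assms(1) by (metis le_neq_implies_less less_imp_add_positive)
  have "2 * (m * (m - 1) div 2) = m * (m - 1)"
    by (rule dvd_mult_div_cancel) (cases m, auto)
  then have "m * (m - 1) + 2 * m + 2 * (n * k) \<le> (m + k) * (m + k + 1)"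
    using assms(3) k by simp
  moreover have "m * (m - 1) + 2 * m = m * (m + 1)"
    by (cases m) (auto simp: algebra_simps)
  ultimately have "k * (2 * n) \<le> k * (2 * m + k + 1)"
    by (simp add: algebra_simps)
  then have "2 * n \<le> 2 * m + k + 1"
    by (rule nat_mult_le_cancel1[OF k(2), THEN iffD1])
  then show False
    using assms(2) k by simp
qed

text \<open>
  Let \<open>W\<close> be the direction space of the affine hull of the agents. Besides the rigid motions within
  \<open>W\<close>, every velocity normal to \<open>W\<close>, chosen independently for each agent, lies in the kernel. If
  \<open>W\<close> were a proper subspace, these would exceed the dimension that the rank leaves for the kernel.
\<close>

lemma rigid_kernel:
  fixes Ef Es :: "'n::{finite,linorder} rel" and p :: "real ^ ('n \<times> 'd::finite)"
  assumes card: "CARD('n) > CARD('d) + 1" and rigid: "infinitesimally_weakly_rigid Ef Es p"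
  shows "span (range (\<lambda>i. edge_vec p i o')) = UNIV"
    and "(\<And>x. x \<in> constraint_set Ef Es \<Longrightarrow> gram_deriv p v x = 0) \<Longrightarrow>
      \<exists>A b. transpose A = - A \<and> (\<forall>i. agent v i = A *v agent p i + b)"
proof -
  define a where "a i = edge_vec p i o'" for i
  define W where "W = span (range a)"
  define W' where "W' = {y \<in> UNIV. \<forall>x\<in>W. orthogonal x y}"
  define Z where "Z = {z :: real ^ ('n \<times> 'd). \<forall>i. agent z i \<in> W'}"
  define K where "K = {v. rigidity_matrix Ef Es p *v v = 0}"
  \<comment> \<open>\<open>D\<close> parametrises the explicit motions: a rotation and a translation
    within \<open>W\<close>, and arbitrary normal velocities. \<open>L\<close> turns them into a
    stacked velocity, rotating about agent \<open>o'\<close>.\<close>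
  define D where "D = skew_maps_into W \<times> W \<times> Z"
  define L where "L = (\<lambda>(A :: real ^ 'd ^ 'd, b :: real ^ 'd, z :: real ^ ('n \<times> 'd)). stack (\<lambda>i. A *v a i + b + agent z i))"
  have K: "v \<in> K \<longleftrightarrow> (\<forall>x\<in>constraint_set Ef Es. gram_deriv p v x = 0)" for v
    by (auto simp: K_def rigidity_matrix_mult vec_eq_iff)
  have subW: "subspace W" "subspace W'"
    by (auto simp: W_def W'_def subspace_orthogonal_to_vectors)
  have aW: "a i \<in> W" for i
    by (simp add: W_def span_base)
  have eW: "edge_vec p i j \<in> W" for i j
  proof -
    have "edge_vec p i j = a i - a j"
      by (simp add: a_def edge_vec_def)
    then show ?thesis
      using aW subW(1) by (simp add: subspace_diff)
  qed
  have WW': "x \<in> W \<Longrightarrow> y \<in> W' \<Longrightarrow> x \<bullet> y = 0" for x y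
    by (simp add: W'_def orthogonal_def)
  have subsp: "subspace (skew_maps_into W)" "subspace Z"
    using subW by (simp_all add: subspace_skew_maps_into)
      (auto simp: Z_def subspace_def agent_add agent_scaleR)
  then have subD: "subspace D"
    unfolding D_def using subW(1) by (intro subspace_Times)
  have linL: "linear L"
  proof (rule linearI)
    show "L (x + y) = L x + L y" for x y
      by (cases x, cases y) (simp add: L_def, rule eq_if_agent_eq,
          simp add: agent_add matrix_vector_mult_add_rdistrib)
    show "L (c *\<^sub>R x) = c *\<^sub>R L x" for c x
      by (cases x) (simp add: L_def, rule eq_if_agent_eq,
          simp add: agent_scaleR scaleR_matrix_vector_assoc[symmetric] scaleR_add_right)
  qed
  have subK: "subspace K"
    using linear_subspace_kernel[of "(*v) (rigidity_matrix Ef Es p)"] by (simp add: K_def)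
  have LK: "L ` D \<subseteq> K"
  proof clarify
    fix A b z assume "(A, b, z) \<in> D"
    then have A: "transpose A = - A" and z: "\<And>i. agent z i \<in> W'"
      by (auto simp: D_def Z_def skew_maps_into_def)
    have e: "edge_vec (L (A, b, z)) i j = A *v edge_vec p i j + (agent z i - agent z j)" for i j
      by (simp add: edge_vec_def L_def a_def matrix_vector_mult_diff_distrib)
    have "gram_deriv p (L (A, b, z)) (i, j, k) = 0" for i j k
    proof -
      have "agent z i - agent z k \<in> W'" "agent z i - agent z j \<in> W'"
        using z subW(2) by (simp_all add: subspace_diff)
      then have "edge_vec p i j \<bullet> (agent z i - agent z k) = 0"
        and "(agent z i - agent z j) \<bullet> edge_vec p i k = 0"
        using WW' eW by (simp_all add: inner_commute[of _ "edge_vec p i k"])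
      then show ?thesis
        by (simp add: gram_deriv_def e inner_add_left inner_add_right inner_skew[OF A])
    qed
    then show "L (A, b, z) \<in> K"
      by (auto simp: K)
  qed
  have "inj_on L D"
    unfolding linear_inj_on_iff_eq_0[OF linL subD]
  proof clarify
    fix A b z assume D: "(A, b, z) \<in> D" and L: "L (A, b, z) = 0"
    then have A: "transpose A = - A" "\<And>x. A *v x \<in> W" and b: "b \<in> W" and z: "\<And>i. agent z i \<in> W'"
      by (auto simp: D_def Z_def skew_maps_into_def)
    have eq: "A *v a i + b = - agent z i" for i
      using arg_cong[OF L, of "\<lambda>v. agent v i"] by (simp add: L_def eq_neg_iff_add_eq_0)
    have "- agent z i \<in> W" for i
      using A b subW by (simp add: subspace_add eq[symmetric])
    then have "(A *v a i + b) \<bullet> (A *v a i + b) = 0" for i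
      using WW'[of "A *v a i + b" "agent z i"] z eq[of i] by simp
    then have Ab: "A *v a i + b = 0" for i
      by simp
    \<comment> \<open>Agent \<open>o'\<close> is the centre of rotation, as
      \<open>a o' = 0\<close>.\<close>
    then have "b = 0"
      using Ab[of o'] by (simp add: a_def edge_vec_def)
    then have Aa: "A *v a i = 0" for i
      using Ab by simp
    have "A *v x = 0" for x
    proof -
      have "A *v w = 0" if "w \<in> W" for w
        using that unfolding W_def
      proof (induction rule: span_induct)
        case base
        show ?case
          by (rule linear_subspace_kernel[OF matrix_vector_mul_linear])
      next
        case (step x)
        then show ?case using Aa by auto
      qed
      \<comment> \<open>\<open>A\<close> maps into \<open>W\<close>, where it vanishes; skewness
        turns A (A x) = 0 into |A x| = 0.\<close>
      then have "A *v (A *v x) = 0"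
        using A(2) by blast
      then have "(A *v x) \<bullet> (A *v x) = 0"
        using inner_skew[OF A(1), of x "A *v x"] by simp
      then show ?thesis by simp
    qed
    then have "A = 0"
      by (simp add: matrix_eq)
    moreover have "z = 0"
      using eq Ab by (intro eq_if_agent_eq) (simp add: \<open>b = 0\<close> Aa)
    ultimately show "(A, b, z) = 0"
      using \<open>b = 0\<close> by (simp add: zero_prod_def)
  qed
  then have "dim (L ` D) = dim D"
    using dim_image_eq[OF linL] subD by (metis span_eq_iff)
  also have "dim D = dim (skew_maps_into W) + dim W + dim Z"
    unfolding D_def using subsp subW(1) by (simp add: dim_Times subspace_Times)
  finally have "dim W * (dim W - 1) div 2 + dim W + CARD('n) * dim W' \<le> dim (L ` D)"
    using dim_skew_maps_into[OF subW(1)] dim_blockwise[OF subW(2), where 'n = 'n]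
    unfolding Z_def by linarith
  moreover have dimW': "dim W' = CARD('d) - dim W"
    using dim_subspace_orthogonal_to_vectors[OF subW(1) subspace_UNIV] by (simp add: W'_def)
  ultimately have lower: "dim W * (dim W - 1) div 2 + dim W + CARD('n) * (CARD('d) - dim W) \<le> dim (L ` D)"
    by simp
  \<comment> \<open>The rank hypothesis leaves at most d(d+1)/2 dimensions for the kernel.\<close>
  have "real (rank (rigidity_matrix Ef Es p) + dim K) \<le> real (CARD('n) * CARD('d))"
    using rank_add_dim_kernel_le[of "rigidity_matrix Ef Es p"] unfolding K_def
    by (simp only: of_nat_le_iff card_prod)
  then have "real (2 * dim K) \<le> real (CARD('d) * (CARD('d) + 1))"
    using rigid by (simp add: infinitesimally_weakly_rigid_def field_simps)
  then have upper: "2 * dim K \<le> CARD('d) * (CARD('d) + 1)"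
    by (simp only: of_nat_le_iff)
  have "dim (L ` D) \<le> dim K"
    by (rule dim_subset[OF LK])
  have dimW: "dim W = CARD('d)"
  proof (rule motion_count_imp_full[OF _ card])
    show "dim W \<le> CARD('d)"
      using dim_subset_UNIV[of W] by simp
    show "2 * (dim W * (dim W - 1) div 2 + dim W + CARD('n) * (CARD('d) - dim W))
        \<le> CARD('d) * (CARD('d) + 1)"
      by (rule order_trans[OF mult_le_mono2[OF order_trans[OF lower \<open>dim (L ` D) \<le> dim K\<close>]] upper])
  qed
  then have WU: "W = UNIV"
    using dim_eq_full[of W] subW(1) by (metis DIM_cart DIM_real mult.right_neutral span_eq_iff)
  then show "span (range (\<lambda>i. edge_vec p i o')) = UNIV"
    by (simp add: W_def a_def[abs_def])
  have "W' = {0}"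
    by (auto simp: W'_def WU orthogonal_def intro: orthogonal_self[unfolded orthogonal_def, THEN iffD1])
  \<comment> \<open>The bound d(d+1)/2 is exactly the number of rotations and translations of the
    full space, so the explicit motions fill the kernel.\<close>
  have count: "CARD('d) * (CARD('d) + 1) = 2 * (CARD('d) * (CARD('d) - 1) div 2 + CARD('d))"
  proof -
    have "2 * (CARD('d) * (CARD('d) - 1) div 2) = CARD('d) * (CARD('d) - 1)"
      by (rule dvd_mult_div_cancel) auto
    then show ?thesis
      by (cases "CARD('d)") (auto simp: algebra_simps)
  qed
  have "CARD('d) * (CARD('d) - 1) div 2 + CARD('d) \<le> dim (L ` D)"
    using lower by (simp add: dimW)
  from order_trans[OF upper[unfolded count] mult_le_mono2[OF this]]
  have "dim K \<le> dim (L ` D)"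
    by simp
  then have KL: "L ` D = K"
    using subspace_dim_equal[OF linear_subspace_image[OF linL subD] subK LK] by simp
  show "\<exists>A b. transpose A = - A \<and> (\<forall>i. agent v i = A *v agent p i + b)"
    if "\<And>x. x \<in> constraint_set Ef Es \<Longrightarrow> gram_deriv p v x = 0"
  proof -
    have "v \<in> L ` D"
      using that by (simp add: KL K)
    then obtain A b z where v: "v = L (A, b, z)" and A: "transpose A = - A"
      and "\<And>i. agent z i \<in> W'"
      by (auto simp: D_def Z_def skew_maps_into_def)
    then have "agent z i = 0" for i
      using \<open>W' = {0}\<close> by auto
    \<comment> \<open>Rotation about agent \<open>o'\<close> becomes rotation about the origin at
      the cost of a translation.\<close>
    then have "agent v i = A *v agent p i + (b - A *v agent p o')" for i
      by (simp add: v L_def a_def edge_vec_def matrix_vector_mult_diff_distrib)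
    then show ?thesis
      using A by blast
  qed
qed

section \<open>The nearest point of the target set\<close>

lemma target_set_iff:
  "p \<in> target_set q \<longleftrightarrow> (\<forall>i j k. edge_vec p i j \<bullet> edge_vec p i k = edge_vec q i j \<bullet> edge_vec q i k)"
  by (simp add: target_set_def edge_vec_def)

lemma gram_entry_target_set: "y \<in> target_set p \<Longrightarrow> gram_entry y x = gram_entry p x"
  by (cases x) (simp add: target_set_iff gram_entry_def)

lemma closed_target_set: "closed (target_set p)"
proof -
  have "target_set p =
      {q. \<forall>i j k. edge_vec q i j \<bullet> edge_vec q i k = edge_vec p i j \<bullet> edge_vec p i k}"
    using target_set_iff by blast
  then show ?thesis
    by (simp only:) (intro closed_Collect_all closed_Collect_eq continuous_on_inner continuous_on_const
      linear_continuous_on linear_edge_vec[unfolded linear_conv_bounded_linear])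
qed

text \<open>
  The Cayley transform \<open>(I + s T / 2) (I - s T / 2)\<^sup>-\<^sup>1\<close> of a skew map is orthogonal, so it yields
  a curve of congruent configurations through \<open>p\<close> with velocity \<open>T p\<close>.
\<close>

lemma nearest_point_skew_velocity:
  fixes T :: "'a::euclidean_space \<Rightarrow> 'a"
  assumes T: "linear T" and skew: "\<And>x. x \<bullet> T x = 0"
    and curve: "\<And>s u. u - (s / 2) *\<^sub>R T u = p \<Longrightarrow> u + (s / 2) *\<^sub>R T u + s *\<^sub>R b \<in> M"
    and nearest: "\<And>m. m \<in> M \<Longrightarrow> norm h \<le> norm (p + h - m)"
  shows "h \<bullet> (T p + b) \<le> 0"
proof -
  obtain B where B: "B > 0" "\<And>x. norm (T x) \<le> B * norm x"
    using linear_bounded_pos[OF T] by blast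
  \<comment> \<open>\<open>N\<close> bounds the second-order terms: the square of the chord velocity
    \<open>w = T u + b\<close>, and the error of replacing \<open>T p\<close> by
    \<open>T u\<close>.\<close>
  define N where "N = (B * norm p + norm b)\<^sup>2 + norm h * (B * (B * norm p))"
  have N: "0 \<le> N"
    using B by (simp add: N_def)
  have bound: "2 * (h \<bullet> (T p + b)) \<le> s * N" if s: "s > 0" for s
  proof -
    let ?g = "\<lambda>u. u - (s / 2) *\<^sub>R T u"
    \<comment> \<open>Pythagoras, since \<open>u\<close> is orthogonal to \<open>T u\<close>. It
      yields both the invertibility of \<open>?g\<close> and
      \<open>norm u \<le> norm p\<close>.\<close>
    have norm_g: "(norm u)\<^sup>2 \<le> (norm (?g u))\<^sup>2" for u
    proof -
      have "(norm (?g u))\<^sup>2 = (norm u)\<^sup>2 + (norm ((s / 2) *\<^sub>R T u))\<^sup>2"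
        unfolding dot_square_norm[symmetric]
        by (simp only: inner_diff_left inner_diff_right inner_scaleR_left inner_scaleR_right
            skew inner_commute[of "T u" u]) simp
      then show ?thesis by simp
    qed
    have "linear (\<lambda>u. u - c *\<^sub>R T u)" for c
      by (rule linearI) (simp_all add: linear_add[OF T] linear_scale[OF T] algebra_simps)
    then have lin: "linear ?g" .
    moreover have "inj ?g"
      unfolding linear_injective_0[OF lin]
    proof (intro allI impI)
      fix u assume "?g u = 0"
      have "(norm u)\<^sup>2 \<le> 0"
        using norm_g[of u] unfolding \<open>?g u = 0\<close> by simp
      then show "u = 0"
        by simp
    qed
    ultimately have "surj ?g"
      by (rule linear_inj_imp_surj)
    then obtain u where "p = ?g u"
      by (rule surjE)
    note u = this[symmetric]
    have nu: "norm u \<le> norm p"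
      using norm_g[of u] unfolding u by (rule power2_le_imp_le) simp
    \<comment> \<open>The curve point at parameter \<open>s\<close> is \<open>p\<close> plus
      \<open>s\<close> times \<open>w\<close>.\<close>
    define w where "w = T u + b"
    have "p + h - (u + (s / 2) *\<^sub>R T u + s *\<^sub>R b) = h - s *\<^sub>R w"
    proof -
      have "s *\<^sub>R w = (s / 2) *\<^sub>R T u + (s / 2) *\<^sub>R T u + s *\<^sub>R b"
        by (simp only: w_def scaleR_add_right scaleR_add_left[symmetric] field_sum_of_halves)
      moreover have "u - a + h - (u + a + b') = h - (a + a + b')" for a b'
        by (simp add: algebra_simps)
      ultimately show ?thesis
        unfolding u[symmetric] by (simp only:)
    qed
    then have "norm h \<le> norm (h - s *\<^sub>R w)"
      using nearest[OF curve[OF u]] by (simp only:)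
    then have "h \<bullet> h \<le> (h - s *\<^sub>R w) \<bullet> (h - s *\<^sub>R w)"
      by (simp add: norm_le)
    then have "s * (2 * (h \<bullet> w)) \<le> s * (s * (w \<bullet> w))"
      by (simp only: inner_diff_left inner_diff_right inner_scaleR_left inner_scaleR_right
          inner_commute[of w h]) (simp add: algebra_simps)
    then have hw: "2 * (h \<bullet> w) \<le> s * (norm w)\<^sup>2"
      using s by (simp add: dot_square_norm)
    have nTu: "norm (T u) \<le> B * norm p"
      by (rule order_trans[OF B(2)]) (use B(1) nu in \<open>simp add: mult_left_mono\<close>)
    have "norm w \<le> B * norm p + norm b"
      unfolding w_def by (rule norm_triangle_le) (use nTu in simp)
    then have nw: "s * (norm w)\<^sup>2 \<le> s * (B * norm p + norm b)\<^sup>2"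
      using s by (simp add: power_mono)
    have "T p = T u - (s / 2) *\<^sub>R T (T u)"
      unfolding u[symmetric] by (simp add: linear_diff[OF T] linear_scale[OF T])
    then have "h \<bullet> (T p + b) = h \<bullet> w - (s / 2) * (h \<bullet> T (T u))"
      by (simp add: w_def inner_add_right inner_diff_right)
    moreover have "- (h \<bullet> T (T u)) \<le> norm h * (B * (B * norm p))"
    proof -
      have "- (h \<bullet> T (T u)) \<le> norm h * norm (T (T u))"
        using Cauchy_Schwarz_ineq2[of h "T (T u)"] by linarith
      also have "norm (T (T u)) \<le> B * (B * norm p)"
        by (rule order_trans[OF B(2)]) (use B(1) nTu in \<open>simp add: mult_left_mono\<close>)
      finally show ?thesis
        by (simp add: mult_left_mono)
    qed
    then have "s * (- (h \<bullet> T (T u))) \<le> s * (norm h * (B * (B * norm p)))"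
      using s by (intro mult_left_mono) auto
    moreover have "s * N = s * (B * norm p + norm b)\<^sup>2 + s * (norm h * (B * (B * norm p)))"
      by (simp only: N_def distrib_left)
    ultimately show ?thesis
      using hw nw by linarith
  qed
  have "2 * (h \<bullet> (T p + b)) \<le> 0"
  proof (rule field_le_epsilon)
    fix e :: real assume e: "0 < e"
    \<comment> \<open>The curve parameter is sent to 0; the \<open>+ 1\<close> covers
      \<open>N = 0\<close>.\<close>
    have "2 * (h \<bullet> (T p + b)) \<le> e / (N + 1) * N"
      using bound[of "e / (N + 1)"] e N by simp
    also have "\<dots> \<le> e"
      using e N by (simp add: field_simps)
    finally show "2 * (h \<bullet> (T p + b)) \<le> 0 + e"
      by simp
  qed
  then show ?thesis by simp
qed

text \<open>Minimality along a Cayley curve gives only an inequality; the velocity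
  \<open>- v\<close> is also a rigid motion, which gives the reverse one.\<close>

lemma nearest_point_orthogonal_to_rigid_motion:
  fixes p h v :: "real ^ ('n::finite \<times> 'd::finite)"
  assumes nearest: "\<And>m. m \<in> target_set p \<Longrightarrow> norm h \<le> norm (p + h - m)"
    and v: "\<exists>A b. transpose A = - A \<and> (\<forall>i. agent v i = A *v agent p i + b)"
  shows "h \<bullet> v = 0"
proof -
  have le: "h \<bullet> v \<le> 0"
    if A: "transpose A = - A" and v: "\<And>i. agent v i = A *v agent p i + b"
    for A :: "real ^ 'd ^ 'd" and b and v :: "real ^ ('n \<times> 'd)"
  proof -
    define T where "T z = stack (\<lambda>i. A *v agent z i)" for z :: "real ^ ('n \<times> 'd)"
    define b' where "b' = (stack (\<lambda>_. b) :: real ^ ('n \<times> 'd))"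
    have aT: "agent (T z) i = A *v agent z i" for z i
      by (simp add: T_def)
    have "v = T p + b'"
      by (rule eq_if_agent_eq) (simp add: v agent_add aT b'_def)
    moreover have "h \<bullet> (T p + b') \<le> 0"
    proof (rule nearest_point_skew_velocity[OF _ _ _ nearest])
      show "linear T"
        by (rule linearI; rule eq_if_agent_eq)
          (simp_all add: aT agent_add agent_scaleR matrix_vector_right_distrib matrix_vector_mult_scaleR)
      show "x \<bullet> T x = 0" for x
      proof -
        have "agent x i \<bullet> (A *v agent x i) = 0" for i
          using inner_skew[OF A, of "agent x i" "agent x i"] by (simp add: inner_commute)
        then show ?thesis
          by (simp add: inner_stack aT)
      qed
      show "u + (s / 2) *\<^sub>R T u + s *\<^sub>R b' \<in> target_set p"
        if u: "u - (s / 2) *\<^sub>R T u = p" for s u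
        unfolding target_set_iff
      proof (intro allI)
        fix i j k
        define e where "e j = edge_vec u i j" for j
        have eT: "edge_vec (T u) i j = A *v e j" for j
          by (simp add: e_def edge_vec_def aT matrix_vector_mult_diff_distrib)
        have "edge_vec b' i j = 0" for j
          by (simp add: b'_def edge_vec_def)
        then have y: "edge_vec (u + (s / 2) *\<^sub>R T u + s *\<^sub>R b') i j = e j + (s / 2) *\<^sub>R (A *v e j)" for j
          by (simp add: edge_vec_add edge_vec_scaleR eT e_def[symmetric])
        have p: "edge_vec p i j = e j - (s / 2) *\<^sub>R (A *v e j)" for j
          unfolding u[symmetric] by (simp add: edge_vec_diff edge_vec_scaleR eT e_def[symmetric])
        \<comment> \<open>Skewness cancels the cross terms, so both sides equal the product of
          \<open>x\<close> and \<open>z\<close> plus c^2 times that of \<open>x'\<close> and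
          \<open>z'\<close>.\<close>
        have cayley: "(x + c *\<^sub>R x') \<bullet> (z + c *\<^sub>R z') = (x - c *\<^sub>R x') \<bullet> (z - c *\<^sub>R z')"
          if "x' \<bullet> z = - (x \<bullet> z')" for x x' z z' :: "real ^ 'd" and c
          by (simp add: inner_add_left inner_add_right inner_diff_left inner_diff_right that algebra_simps)
        show "edge_vec (u + (s / 2) *\<^sub>R T u + s *\<^sub>R b') i j \<bullet> edge_vec (u + (s / 2) *\<^sub>R T u + s *\<^sub>R b') i k =
            edge_vec p i j \<bullet> edge_vec p i k"
          unfolding y p by (rule cayley[OF inner_skew[OF A]])
      qed
    qed
    ultimately show ?thesis by simp
  qed
  obtain A b where A: "transpose A = - A" and vi: "\<And>i. agent v i = A *v agent p i + b"
    using v by blast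
  have "h \<bullet> v \<le> 0"
    by (rule le[OF A vi])
  moreover have "h \<bullet> (- v) \<le> 0"
  proof (rule le)
    have "transpose (- A) = - transpose A"
      by (simp add: transpose_def vec_eq_iff)
    then show "transpose (- A) = - (- A)"
      by (simp only: A)
    have "agent (- v) i = - agent v i" for i
      using agent_diff[of 0 v i] by simp
    moreover have "(- A) *v x = - (A *v x)" for x
      by (simp add: matrix_vector_mult_def vec_eq_iff sum_negf)
    ultimately show "agent (- v) i = (- A) *v agent p i + - b" for i
      by (simp add: vi)
  qed
  ultimately show ?thesis
    by (simp add: inner_minus_right)
qed

text \<open>The nearest-point condition makes \<open>h\<close> orthogonal to all rigid motions,
  hence to the kernel of the rigidity matrix; in finite dimension a linear map is bounded below on
  the orthogonal complement of its kernel.\<close>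

lemma rigid_lower_bound:
  fixes Ef Es :: "'n::{finite,linorder} rel" and p :: "real ^ ('n \<times> 'd::finite)"
  assumes card: "CARD('n) > CARD('d) + 1" and rigid: "infinitesimally_weakly_rigid Ef Es p"
  obtains \<sigma> where "\<sigma> > 0" and "\<And>h. (\<And>m. m \<in> target_set p \<Longrightarrow> norm h \<le> norm (p + h - m)) \<Longrightarrow>
      \<sigma> * (norm h)\<^sup>2 \<le> (\<Sum>x\<in>constraint_set Ef Es. (gram_deriv p h x)\<^sup>2)"
proof -
  define R where "R v = rigidity_matrix Ef Es p *v v" for v
  define S where "S = {h. \<forall>v\<in>{v. R v = 0}. orthogonal v h}"
  have S: "subspace S"
    unfolding S_def by (rule subspace_orthogonal_to_vectors)
  have "bounded_linear R"
    unfolding R_def by (rule matrix_vector_mul_bounded_linear)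
  moreover have "\<forall>h\<in>S. R h = 0 \<longrightarrow> h = 0"
    by (auto simp: S_def orthogonal_def)
  ultimately obtain e where e: "e > 0" "\<And>h. h \<in> S \<Longrightarrow> e * norm h \<le> norm (R h)"
    using injective_imp_isometric[OF closed_subspace[OF S] S] by (metis mult.commute)
  show thesis
  proof
    show "e\<^sup>2 > 0"
      using e(1) by simp
    fix h assume nearest: "\<And>m. m \<in> target_set p \<Longrightarrow> norm h \<le> norm (p + h - m)"
    have "h \<in> S"
      unfolding S_def
    proof clarify
      fix v assume "R v = 0"
      then have "gram_deriv p v x = 0" if "x \<in> constraint_set Ef Es" for x
      proof -
        have "R v $ x = gram_deriv p v x"
          using that by (simp add: R_def rigidity_matrix_mult)
        then show ?thesis
          using \<open>R v = 0\<close> by simp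
      qed
      then have "h \<bullet> v = 0"
        by (intro nearest_point_orthogonal_to_rigid_motion[OF nearest] rigid_kernel(2)[OF card rigid])
      then show "orthogonal v h"
        by (simp add: orthogonal_def inner_commute)
    qed
    then have "(e * norm h)\<^sup>2 \<le> (norm (R h))\<^sup>2"
      using e by (intro power_mono) auto
    also have "\<dots> = (\<Sum>x\<in>UNIV. if x \<in> constraint_set Ef Es then (gram_deriv p h x)\<^sup>2 else 0)"
      unfolding dot_square_norm[symmetric] R_def rigidity_matrix_mult inner_vec_def
      by (intro sum.cong) (auto simp: power2_eq_square)
    also have "\<dots> = (\<Sum>x\<in>constraint_set Ef Es. (gram_deriv p h x)\<^sup>2)"
      by (simp add: sum.If_cases)
    finally show "e\<^sup>2 * (norm h)\<^sup>2 \<le> (\<Sum>x\<in>constraint_set Ef Es. (gram_deriv p h x)\<^sup>2)"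
      by (simp add: power_mult_distrib)
  qed
qed

text \<open>The edge vectors ending at the fixed agent \<open>o'\<close> have the same Gram matrix
  in both configurations, and those of \<open>p\<close> span the space; every other edge vector is a
  difference of two of them.\<close>

lemma target_set_isometry:
  fixes p y :: "real ^ ('n::finite \<times> 'd::finite)"
  assumes span: "span (range (\<lambda>i. edge_vec p i o')) = UNIV" and y: "y \<in> target_set p"
  obtains Q where "orthogonal_transformation Q" and "\<And>i j. edge_vec y i j = Q (edge_vec p i j)"
proof -
  \<comment> \<open>\<open>target_set\<close> compares edges leaving a common agent, whereas these
    end at \<open>o'\<close>; the two signs cancel in the products.\<close>
  have neg: "edge_vec z i o' = - edge_vec z o' i" for z :: "real ^ ('n \<times> 'd)" and i
    by (simp add: edge_vec_def)
  have "edge_vec y i o' \<bullet> edge_vec y j o' = edge_vec p i o' \<bullet> edge_vec p j o'" for i j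
    using y unfolding neg target_set_iff by simp
  then obtain Q where Q: "orthogonal_transformation Q" "\<And>i. edge_vec y i o' = Q (edge_vec p i o')"
    using isometry_of_equal_inner_products[OF _ span, of "\<lambda>i. edge_vec y i o'"] by blast
  have "edge_vec z i j = edge_vec z i o' - edge_vec z j o'" for z :: "real ^ ('n \<times> 'd)" and i j
    by (simp add: edge_vec_def)
  then have "edge_vec y i j = Q (edge_vec p i j)" for i j
    using Q linear_diff[OF orthogonal_transformation_linear[OF Q(1)]] by metis
  then show thesis
    using that Q(1) by blast
qed

text \<open>
  An isometry taking \<open>p\<close> to the nearest point \<open>y\<close> transports the displacement back to \<open>p\<close>,
  where the singular value bound applies; this makes the constants uniform over the unbounded
  target set.
\<close>

lemma uniform_lower_bound:
  fixes Ef Es :: "'n::{finite,linorder} rel" and p :: "real ^ ('n \<times> 'd::finite)"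
  assumes card: "CARD('n) > CARD('d) + 1" and rigid: "infinitesimally_weakly_rigid Ef Es p"
  obtains \<sigma> where "\<sigma> > 0" and "\<And>q y. y \<in> target_set p \<Longrightarrow> infdist q (target_set p) = dist q y \<Longrightarrow>
      \<sigma> * (norm (q - y))\<^sup>2 \<le> (\<Sum>x\<in>constraint_set Ef Es. (gram_deriv y (q - y) x)\<^sup>2)"
proof -
  obtain \<sigma> where \<sigma>: "\<sigma> > 0" "\<And>h. (\<And>m. m \<in> target_set p \<Longrightarrow> norm h \<le> norm (p + h - m)) \<Longrightarrow>
      \<sigma> * (norm h)\<^sup>2 \<le> (\<Sum>x\<in>constraint_set Ef Es. (gram_deriv p h x)\<^sup>2)"
    using rigid_lower_bound[OF card rigid] by blast
  show thesis
  proof (rule that[OF \<sigma>(1)])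
    fix q y assume y: "y \<in> target_set p" and near: "infdist q (target_set p) = dist q y"
    obtain Q where Q: "orthogonal_transformation Q" and yQ: "\<And>i j. edge_vec y i j = Q (edge_vec p i j)"
      using target_set_isometry[OF rigid_kernel(1)[OF card rigid] y] by blast
    note linQ = orthogonal_transformation_linear[OF Q]
    have innQ: "Q u \<bullet> Q v = u \<bullet> v" for u v
      using Q by (simp add: orthogonal_transformation_def)
    define T where "T z = stack (\<lambda>i. Q (agent z i))" for z :: "real ^ ('n \<times> 'd)"
    have eT: "edge_vec (T z) i j = Q (edge_vec z i j)" for z i j
      by (simp add: T_def edge_vec_def linear_diff[OF linQ])
    have T_diff: "T (z - z') = T z - T z'" for z z'
      by (rule eq_if_agent_eq) (simp add: T_def agent_diff linear_diff[OF linQ])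
    have normT: "norm (T z) = norm z" for z
      by (simp add: norm_eq_sqrt_inner inner_stack T_def innQ)
    define h where "h = stack (\<lambda>i. inv Q (agent (q - y) i))"
    have h: "T h = q - y"
      using orthogonal_transformation_surj[OF Q] by (intro eq_if_agent_eq) (simp add: T_def h_def surj_f_inv_f)
    have "norm h \<le> norm (p + h - m)" if m: "m \<in> target_set p" for m
    proof -
      \<comment> \<open>The isometry taking \<open>p\<close> to \<open>y\<close> maps the target set
        into itself, so minimality of \<open>y\<close> for \<open>q\<close> becomes minimality of
        \<open>p\<close> for \<open>p + h\<close>.\<close>
      have "edge_vec (y + T (m - p)) i j = Q (edge_vec m i j)" for i j
        by (simp add: edge_vec_add eT yQ edge_vec_diff linear_diff[OF linQ])
      then have "y + T (m - p) \<in> target_set p"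
        using m by (simp add: target_set_iff innQ)
      then have "dist q y \<le> dist q (y + T (m - p))"
        using near infdist_le by metis
      moreover have "q - (y + T (m - p)) = T (p + h - m)"
        using h T_diff[of h "m - p"] by (simp add: algebra_simps)
      ultimately show ?thesis
        by (metis dist_norm h normT)
    qed
    then have "\<sigma> * (norm h)\<^sup>2 \<le> (\<Sum>x\<in>constraint_set Ef Es. (gram_deriv p h x)\<^sup>2)"
      by (rule \<sigma>(2))
    moreover have "gram_deriv y (q - y) x = gram_deriv p h x" for x
      by (cases x) (simp add: h[symmetric] gram_deriv_def eT yQ innQ)
    moreover have "norm (q - y) = norm h"
      using h normT by metis
    ultimately show "\<sigma> * (norm (q - y))\<^sup>2 \<le> (\<Sum>x\<in>constraint_set Ef Es. (gram_deriv y (q - y) x)\<^sup>2)"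
      by simp
  qed
qed

section \<open>The closed-loop vector field\<close>

lemma potential_eq:
  "potential Ef Es q p =
     1 / 2 * (\<Sum>x\<in>constraint_set Ef Es. (gram_entry p x - gram_entry q x)\<^sup>2)"
  unfolding potential_def by (simp add: gram_entry_def split_def)

lemma has_derivative_potential:
  "(potential Ef Es q has_derivative
     (\<lambda>v. \<Sum>x\<in>constraint_set Ef Es. (gram_entry p x - gram_entry q x) * gram_deriv p v x)) (at p)"
proof -
  have "((\<lambda>p. 1 / 2 * (\<Sum>x\<in>constraint_set Ef Es. (gram_entry p x - gram_entry q x)\<^sup>2)) has_derivative
     (\<lambda>v. 1 / 2 * (\<Sum>x\<in>constraint_set Ef Es. 2 * gram_deriv p v x * (gram_entry p x - gram_entry q x)))) (at p)"
    by (intro has_derivative_mult_right has_derivative_sum)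
      (auto intro!: derivative_eq_intros has_derivative_gram_entry)
  then show ?thesis
    unfolding potential_eq[abs_def]
    by (rule has_derivative_eq_rhs) (simp add: sum_distrib_left mult_ac)
qed

text \<open>Moving agent \<open>i\<close> alone is an affine map into the stacked space; the chain
  rule along it reads the partial gradient off the full derivative of the potential.\<close>

lemma inner_control:
  fixes p q :: "real ^ ('n::{finite,linorder} \<times> 'd::finite)"
  shows "w \<bullet> control Ef Es q i p = - (\<Sum>x\<in>constraint_set Ef Es.
    (gram_entry p x - gram_entry q x) * gram_deriv p (stack ((\<lambda>_. 0)(i := w))) x)"
proof -
  define \<iota> where "\<iota> w = (stack ((\<lambda>_. 0)(i := w)) :: real ^ ('n \<times> 'd))" for w
  define F where "F v = (\<Sum>x\<in>constraint_set Ef Es.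
    (gram_entry p x - gram_entry q x) * gram_deriv p v x)" for v
  have lin\<iota>: "linear \<iota>"
    by (rule linearI; rule eq_if_agent_eq) (simp_all add: \<iota>_def agent_add agent_scaleR)
  have "linear F"
    using has_derivative_potential has_derivative_linear unfolding F_def by blast
  then have lin: "linear (\<lambda>w. F (\<iota> w))"
    using lin\<iota> linear_compose[of \<iota> F] by (simp add: o_def)
  define c where "c = stack ((agent p)(i := 0))"
  have upd: "stack ((agent p)(i := x)) = c + \<iota> x" for x
    by (rule eq_if_agent_eq) (simp add: \<iota>_def c_def agent_add)
  have "((\<lambda>x. c + \<iota> x) has_derivative (\<lambda>w. 0 + \<iota> w)) (at (agent p i))"
    using lin\<iota>[unfolded linear_conv_bounded_linear]
    by (intro has_derivative_add has_derivative_const bounded_linear_imp_has_derivative)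
  then have "((\<lambda>x. stack ((agent p)(i := x))) has_derivative \<iota>) (at (agent p i))"
    by (simp only: upd add_0_left)
  moreover have "(potential Ef Es q has_derivative F) (at (stack ((agent p)(i := agent p i))))"
    using has_derivative_potential[of Ef Es q p] by (simp add: F_def[abs_def])
  ultimately have der: "((\<lambda>x. potential Ef Es q (stack ((agent p)(i := x)))) has_derivative
      (\<lambda>w. F (\<iota> w))) (at (agent p i))"
    using has_derivative_compose by blast
  \<comment> \<open>The Riesz representative of the differential; exhibiting it gives the definite
    description in \<open>gradient\<close> its value.\<close>
  define G where "G = (\<Sum>b\<in>Basis. F (\<iota> b) *\<^sub>R b)"
  have G: "F (\<iota> w) = w \<bullet> G" for w
  proof -
    have "F (\<iota> w) = F (\<iota> (\<Sum>b\<in>Basis. (w \<bullet> b) *\<^sub>R b))"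
      by (simp add: euclidean_representation)
    also have "\<dots> = (\<Sum>b\<in>Basis. (w \<bullet> b) *\<^sub>R F (\<iota> b))"
      by (simp only: linear_sum[OF lin] linear_scale[OF lin] real_scaleR_def)
    also have "\<dots> = w \<bullet> G"
      by (simp add: G_def inner_sum_right mult.commute)
    finally show ?thesis .
  qed
  have "gradient (\<lambda>x. potential Ef Es q (stack ((agent p)(i := x)))) (agent p i) = G"
    by (rule gradient_eqI) (use der in \<open>simp add: gderiv_def G\<close>)
  then have "w \<bullet> control Ef Es q i p = - F (\<iota> w)"
    by (simp add: control_def agent_gradient_def G)
  then show ?thesis
    by (simp add: F_def \<iota>_def)
qed

text \<open>Summing the agent-wise laws against the blocks of \<open>h\<close> reassembles the full
  derivative by linearity: the closed loop is minus the gradient of the potential.\<close>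

lemma inner_closed_loop:
  fixes p q :: "real ^ ('n::{finite,linorder} \<times> 'd::finite)"
  shows "h \<bullet> closed_loop Ef Es q p = - (\<Sum>x\<in>constraint_set Ef Es.
    (gram_entry p x - gram_entry q x) * gram_deriv p h x)"
proof -
  define F where "F v = (\<Sum>x\<in>constraint_set Ef Es.
    (gram_entry p x - gram_entry q x) * gram_deriv p v x)" for v
  have lin: "linear F"
    using has_derivative_potential has_derivative_linear unfolding F_def by blast
  have h: "h = (\<Sum>i\<in>UNIV. stack ((\<lambda>_. 0)(i := agent h i)))"
    by (rule eq_if_agent_eq)
      (simp add: linear_sum[OF linear_agent] fun_upd_def if_distrib sum.delta cong: if_cong)
  have "h \<bullet> closed_loop Ef Es q p = (\<Sum>i\<in>UNIV. - F (stack ((\<lambda>_. 0)(i := agent h i))))"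
    by (simp add: inner_stack closed_loop_def inner_control F_def)
  also have "\<dots> = - F h"
    by (subst (2) h) (simp add: linear_sum[OF lin] sum_negf)
  finally show ?thesis
    by (simp add: F_def)
qed

theorem theorem4p3:
  fixes Ef Es :: "'n::{finite,linorder} rel"
    and pstar :: "real ^ ('n \<times> 'd::finite)"
  assumes "simple_graph Ef" and "simple_graph Es" and "Ef \<subseteq> Es"
    and "CARD('n) > CARD('d) + 1"
    and "infinitesimally_weakly_rigid Ef Es pstar"
  shows "locally_exponentially_stable (closed_loop Ef Es pstar) (target_set pstar)"
proof -
  let ?C = "constraint_set Ef Es"
  obtain \<sigma> where \<sigma>: "\<sigma> > 0"
    "\<And>q y. y \<in> target_set pstar \<Longrightarrow> infdist q (target_set pstar) = dist q y \<Longrightarrow>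
      \<sigma> * (norm (q - y))\<^sup>2 \<le> (\<Sum>x\<in>?C. (gram_deriv y (q - y) x)\<^sup>2)"
    using uniform_lower_bound[OF assms(4,5)] by blast
  \<comment> \<open>The factor 40 = 16 * 5/2 comes from the pointwise estimate below;
    \<open>+ 1\<close> keeps \<open>N\<close> positive for an empty constraint set.\<close>
  define N where "N = 40 * real (card ?C) + 1"
  have N: "N > 0"
    by (simp add: N_def)
  \<comment> \<open>Within this distance the quartic remainder costs at most half of the main term
    \<sigma>/2 |h|^2, leaving the rate \<sigma>/4.\<close>
  define \<delta> where "\<delta> = sqrt (\<sigma> / (4 * N))"
  have \<delta>: "\<delta> > 0" "\<delta>\<^sup>2 = \<sigma> / (4 * N)"
    using \<sigma>(1) N by (simp_all add: \<delta>_def)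
  show ?thesis
  proof (rule locally_exponentially_stable_of_nearest_point[OF closed_target_set \<delta>(1)])
    show "0 < \<sigma> / 4"
      using \<sigma>(1) by simp
    fix q y assume y: "y \<in> target_set pstar" "infdist q (target_set pstar) = dist q y" "dist q y < \<delta>"
    define h where "h = q - y"
    have q: "q = y + h"
      by (simp add: h_def)
    have entry: "(gram_deriv y h x)\<^sup>2 / 2 - 40 * (norm h)\<^sup>2 * (norm h)\<^sup>2 \<le>
        (gram_entry q x - gram_entry pstar x) * gram_deriv q h x" for x
    proof -
      define a g where "a = gram_deriv y h x" and "g = gram_entry h x"
      have "\<bar>g\<bar>\<^sup>2 \<le> (4 * (norm h)\<^sup>2)\<^sup>2"
        unfolding g_def by (intro power_mono abs_gram_entry_le) auto
      then have "g\<^sup>2 \<le> 16 * ((norm h)\<^sup>2 * (norm h)\<^sup>2)"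
        by (simp add: power2_eq_square)
      \<comment> \<open>This square absorbs the cross term 3ag of (a + g)(a + 2g), at the price of
        half of \<open>a\<^sup>2\<close> and the factor 5/2.\<close>
      moreover have "0 \<le> (a + 3 * g)\<^sup>2"
        by simp
      then have "a\<^sup>2 / 2 - 5 / 2 * g\<^sup>2 \<le> (a + g) * (a + 2 * g)"
        by (simp add: power2_eq_square algebra_simps)
      moreover have "gram_entry q x - gram_entry pstar x = a + g" "gram_deriv q h x = a + 2 * g"
        by (simp_all add: q gram_entry_add gram_deriv_add_self gram_entry_target_set[OF y(1)] a_def g_def)
      ultimately show ?thesis
        by (simp add: a_def[symmetric] mult.assoc)
    qed
    have "\<sigma> / 2 * (norm h)\<^sup>2 - real (card ?C) * (40 * (norm h)\<^sup>2 * (norm h)\<^sup>2) \<le>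
        (\<Sum>x\<in>?C. (gram_deriv y h x)\<^sup>2) / 2 - real (card ?C) * (40 * (norm h)\<^sup>2 * (norm h)\<^sup>2)"
      using \<sigma>(2)[OF y(1,2)] by (simp add: h_def)
    also have "\<dots> = (\<Sum>x\<in>?C. (gram_deriv y h x)\<^sup>2 / 2 - 40 * (norm h)\<^sup>2 * (norm h)\<^sup>2)"
      by (simp add: sum_subtractf sum_divide_distrib)
    also have "\<dots> \<le> (\<Sum>x\<in>?C. (gram_entry q x - gram_entry pstar x) * gram_deriv q h x)"
      by (intro sum_mono entry)
    also have "\<dots> = - (h \<bullet> closed_loop Ef Es pstar q)"
      by (simp add: inner_closed_loop)
    finally have 1: "h \<bullet> closed_loop Ef Es pstar q \<le>
        - (\<sigma> / 2 * (norm h)\<^sup>2) + real (card ?C) * (40 * (norm h)\<^sup>2 * (norm h)\<^sup>2)"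
      by linarith
    have "(norm h)\<^sup>2 \<le> \<delta>\<^sup>2"
      using y(3) by (intro power_mono) (auto simp: h_def dist_norm)
    then have "N * (norm h)\<^sup>2 \<le> \<sigma> / 4"
      using N by (simp add: \<delta>(2) field_simps)
    moreover have "40 * real (card ?C) * (norm h)\<^sup>2 \<le> N * (norm h)\<^sup>2"
      by (intro mult_right_mono) (auto simp: N_def)
    ultimately have "40 * real (card ?C) * (norm h)\<^sup>2 * (norm h)\<^sup>2 \<le> \<sigma> / 4 * (norm h)\<^sup>2"
      by (intro mult_right_mono) auto
    then have "h \<bullet> closed_loop Ef Es pstar q \<le> - (\<sigma> / 4) * (norm h)\<^sup>2"
      using 1 by (simp add: mult_ac)
    then show "(q - y) \<bullet> closed_loop Ef Es pstar q \<le> - (\<sigma> / 4) * (norm (q - y))\<^sup>2"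
      by (simp add: h_def)
  qed
qed

end
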